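(* Let $G=(V,E)\in\mathcal{G}$, $V=\mathbb{Z}$, be a quasi-transitive graph with translation period $L$. Let $\sigma_0\in\{+1,-1\}^{V}$ be the step configuration with $\sigma_0(u)=-1$ for $u\le 0$ and $\sigma_0(u)=+1$ for $u>0$. Then $G$ has the shrink property if and only if there exists a finite sequence of valid flips starting from $\sigma_0$ that reaches a configuration $\sigma_\tau$ satisfying $$\sigma_\tau\le \tau_L\sigma_0 ,$$ where $\tau_L$ denotes the spatial translation by one period $L$ towards the right.
   Context: $\mathcal{G}$ is the collection of connected graphs $G=(\mathbb{Z},E)$ such that: (A1) there exists an integer $L\ge 1$ (a translation period) with $\{x,y\}\in E \iff \{x+L,y+L\}\in E$ for all $x,y\in\mathbb{Z}$; (A2) the maximal degree of $G$ is finite. For $S\subset V$ and $u\in V$, write $\deg_S(u)=|\{v\in S:\{u,v\}\in E\}|$. $G$ has the shrink property if for each nonempty finite $S\subset V$ there exists $u\in S$ with $\deg_{V\setminus S}(u)\ge \deg_S(u)$. For $\sigma\in\{+1,-1\}^V$ and $v\in V$ let $\Delta\mathcal{H}_v(\sigma)=2\sum_{u:\{u,v\}\in E}\sigma(u)\sigma(v)$. A valid flip in configuration $\sigma$ is the change of the spin of a single vertex $v$ from $+1$ to $-1$, allowed when $\sigma(v)=+1$ and $\Delta\mathcal{H}_v(\sigma)\le 0$. Configurations are ordered coordinatewise: $\sigma\le\sigma'$ iff $\sigma(v)\le\sigma'(v)$ for all $v$. The translation is $(\tau_L\sigma)(x)=\sigma(x-L)$, so $\tau_L\sigma_0$ equals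 $-1$ at $u\le L$ and $+1$ at $u>L$. *)

theory Defs
  imports Main
begin

(* A graph with vertex set the integers is given by its edge set, a set of unordered
   pairs of distinct integers. *)
definition simple_edges :: "int set set \<Rightarrow> bool" where
  "simple_edges E \<longleftrightarrow> (\<forall>e\<in>E. \<exists>x y. x \<noteq> y \<and> e = {x, y})"

definition graph_connected :: "int set set \<Rightarrow> bool" where
  "graph_connected E \<longleftrightarrow> (\<forall>x y. (\<lambda>u v. {u, v} \<in> E)\<^sup>*\<^sup>* x y)"

definition nbrs :: "int set set \<Rightarrow> int \<Rightarrow> int set" where
  "nbrs E v = {u. {u, v} \<in> E}"

definition translation_period :: "int set set \<Rightarrow> int \<Rightarrow> bool" where
  "translation_period E L \<longleftrightarrow>
     L \<ge> 1 \<and> (\<forall>x y. {x, y} \<in> E \<longleftrightarrow> {x + L, y + L} \<in> E)"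

(* Finiteness of the neighbourhoods is stated explicitly because card of an infinite set is 0. *)
definition bounded_degree :: "int set set \<Rightarrow> bool" where
  "bounded_degree E \<longleftrightarrow> (\<exists>d. \<forall>v. finite (nbrs E v) \<and> card (nbrs E v) \<le> d)"

definition graph_class :: "int set set set" where
  "graph_class = {E. simple_edges E \<and> graph_connected E \<and>
     (\<exists>L. translation_period E L) \<and> bounded_degree E}"

definition deg_in :: "int set set \<Rightarrow> int set \<Rightarrow> int \<Rightarrow> nat" where
  "deg_in E S u = card {v \<in> S. {u, v} \<in> E}"

definition shrink_property :: "int set set \<Rightarrow> bool" where
  "shrink_property E \<longleftrightarrow>
     (\<forall>S. S \<noteq> {} \<and> finite S \<longrightarrow> (\<exists>u\<in>S. deg_in E (UNIV - S) u \<ge> deg_in E S u))"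

(* Spin configurations are integer-valued functions with values in {1, -1}; their coordinatewise
   order is the library order on functions. *)
type_synonym config = "int \<Rightarrow> int"

definition configs :: "config set" where
  "configs = {\<sigma>. \<forall>v. \<sigma> v \<in> {1, -1}}"

definition delta_H :: "int set set \<Rightarrow> int \<Rightarrow> config \<Rightarrow> int" where
  "delta_H E v \<sigma> = 2 * (\<Sum>u\<in>nbrs E v. \<sigma> u * \<sigma> v)"

definition valid_flip :: "int set set \<Rightarrow> config \<Rightarrow> config \<Rightarrow> bool" where
  "valid_flip E \<sigma> \<sigma>' \<longleftrightarrow>
     \<sigma> \<in> configs \<and> (\<exists>v. \<sigma> v = 1 \<and> delta_H E v \<sigma> \<le> 0 \<and> \<sigma>' = \<sigma>(v := -1))"

definition step_config :: config where
  "step_config u = (if u \<le> 0 then -1 else 1)"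

definition translate :: "int \<Rightarrow> config \<Rightarrow> config" where
  "translate L \<sigma> = (\<lambda>x. \<sigma> (x - L))"

end

theory Submission
  imports Defs
begin

text \<open>
  A configuration is encoded by its set \<open>A\<close> of plus spins. A valid flip then removes from \<open>A\<close> a
  vertex with at most as many neighbours inside \<open>A\<close> as outside; call this an erosion step. A set is
  stable if none of its vertices can be removed, so the shrink property says that no nonempty finite
  set is stable. Two facts drive everything. Erosion is monotone: a vertex that can be removed from
  \<open>A\<close> can be removed from every subset of \<open>A\<close> containing it. Hence a stable subset of \<open>A\<close> is never
  touched, and the vertices of \<open>A\<close> that survive every erosion form the largest stable subset, the core
  of \<open>A\<close> (\<open>erodes_outside_core\<close>). And erosion never increases the size of the edge boundary.

  Suppose that flips starting from the half-line \<open>{0<..}\<close> remove all of \<open>{1..L}\<close>. A nonempty finite stable set could be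
  translated by a multiple of the period so that it lies in \<open>{0<..}\<close> with minimum in \<open>{1..L}\<close>; being
  stable it is never touched, but its minimum has been removed.

  Conversely, assume the shrink property, and suppose that the core \<open>Q\<close> of \<open>{0<..}\<close> is nonempty. If
  infinitely many vertices of the half-line were lost, some residue class modulo \<open>L\<close> would be lost
  entirely, while another, containing a point of \<open>Q\<close>, would be kept from some point on. Paths joining the two
  classes then give arbitrarily many boundary edges after a suitable finite erosion, although the
  boundary cannot grow. So \<open>Q\<close> contains a half-line (\<open>core_absorbs\<close>), and by the same argument in the
  other direction a nonempty core of \<open>{..0}\<close> contains a left half-line. In that case a far
  left translate of \<open>Q\<close> would meet that core in a nonempty finite set which is stable, because
  near each of its ends it agrees with one of two stable sets. The shrink property forbids this, so
  \<open>{..0}\<close>, and with it every left half-line up to a finite change, has empty core and can be eroded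
  away from any finite set (\<open>left_core_empty\<close>, \<open>left_half_core_empty\<close>).

  It remains to turn erosion from the right into erosion from the left. Among all left half-lines up to
  a finite change take one, \<open>X\<close>, with the smallest edge boundary, and a translate \<open>Q'\<close> of \<open>Q\<close>
  that meets \<open>X\<close>. Erode \<open>X\<close> until it is disjoint from \<open>Q'\<close>. By minimality no step lowers the boundary,
  so every removed vertex has equally many neighbours on both sides, and each step read backwards is
  an erosion step of the complement. The step that removes the last vertex of \<open>Q'\<close> from the left set,
  read backwards, erodes a superset of \<open>Q'\<close> at a vertex of \<open>Q'\<close>, contradicting the stability of \<open>Q'\<close>
  (\<open>minimal_boundary_blocks_erosion\<close>).
\<close>

section \<open>Erosion of sets and stable sets\<close>

locale locally_finite_graph =
  fixes E :: "int set set"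
  assumes simple: "simple_edges E"
    and finite_nbrs: "finite {v. {u, v} \<in> E}"
begin

definition erode :: "int set \<Rightarrow> int set \<Rightarrow> bool" where
  "erode A A' \<longleftrightarrow> (\<exists>v\<in>A. deg_in E A v \<le> deg_in E (UNIV - A) v \<and> A' = A - {v})"

definition stable :: "int set \<Rightarrow> bool" where
  "stable S \<longleftrightarrow> (\<forall>v\<in>S. deg_in E (UNIV - S) v < deg_in E S v)"

definition core :: "int set \<Rightarrow> int set" where
  "core A = \<Union>{S. stable S \<and> S \<subseteq> A}"

text \<open>
  Boundary edges are oriented from the inside to the outside, so that each is counted once.
\<close>

definition boundary :: "int set \<Rightarrow> (int \<times> int) set" where
  "boundary A = {(u, v). u \<in> A \<and> v \<notin> A \<and> {u, v} \<in> E}"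

definition invariant_shift :: "int \<Rightarrow> bool" where
  "invariant_shift d \<longleftrightarrow> (\<forall>x y. {x + d, y + d} \<in> E \<longleftrightarrow> {x, y} \<in> E)"

lemma no_loop: "{v, v} \<notin> E"
  using simple unfolding simple_edges_def by (metis doubleton_eq_iff)

lemma deg_in_mono:
  assumes "\<And>v. v \<in> A \<Longrightarrow> {u, v} \<in> E \<Longrightarrow> v \<in> B"
  shows "deg_in E A u \<le> deg_in E B u"
  unfolding deg_in_def
proof (rule card_mono)
  show "finite {v \<in> B. {u, v} \<in> E}" by (rule finite_subset[OF _ finite_nbrs[of u]]) blast
qed (use assms in blast)

lemma shrink_property_iff_no_finite_stable_set:
  "shrink_property E \<longleftrightarrow> (\<forall>S. finite S \<longrightarrow> stable S \<longrightarrow> S = {})"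
  unfolding shrink_property_def stable_def by (meson linorder_not_le)

lemma core_subset: "core A \<subseteq> A"
  unfolding core_def by blast

lemma stable_subset_core: "stable S \<Longrightarrow> S \<subseteq> A \<Longrightarrow> S \<subseteq> core A"
  unfolding core_def by blast

lemma stable_core: "stable (core A)"
  unfolding stable_def
proof
  fix v assume "v \<in> core A"
  then obtain S where S: "stable S" "S \<subseteq> A" "v \<in> S"
    unfolding core_def by blast
  have sub: "S \<subseteq> core A"
    using S stable_subset_core by blast
  have "deg_in E (UNIV - core A) v \<le> deg_in E (UNIV - S) v"
    using sub by (intro deg_in_mono) auto
  also have "\<dots> < deg_in E S v"
    using S unfolding stable_def by blast
  also have "\<dots> \<le> deg_in E (core A) v"
    using sub by (intro deg_in_mono) auto
  finally show "deg_in E (UNIV - core A) v < deg_in E (core A) v" .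
qed

lemma erode_subset: "erode A A' \<Longrightarrow> A' \<subseteq> A"
  unfolding erode_def by blast

lemma erodes_subset: "erode\<^sup>*\<^sup>* A A' \<Longrightarrow> A' \<subseteq> A"
  by (induction rule: rtranclp_induct) (auto dest: erode_subset)

text \<open>
  Passing from \<open>S\<close> to a larger set moves neighbours from the outside to the inside, which makes it
  only harder to remove a vertex of \<open>S\<close>.
\<close>

lemma erode_preserves_stable_subset:
  assumes "stable S" "S \<subseteq> A" "erode A A'"
  shows "S \<subseteq> A'"
proof -
  obtain v where v: "deg_in E A v \<le> deg_in E (UNIV - A) v" "A' = A - {v}"
    using assms(3) unfolding erode_def by blast
  have "v \<notin> S"
  proof
    assume "v \<in> S"
    then have "deg_in E (UNIV - S) v < deg_in E S v"
      using assms(1) unfolding stable_def by blast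
    moreover have "deg_in E S v \<le> deg_in E A v"
      using assms(2) by (intro deg_in_mono) auto
    moreover have "deg_in E (UNIV - A) v \<le> deg_in E (UNIV - S) v"
      using assms(2) by (intro deg_in_mono) auto
    ultimately show False using v(1) by linarith
  qed
  then show ?thesis using v(2) assms(2) by blast
qed

lemma erodes_preserves_stable_subset:
  assumes "erode\<^sup>*\<^sup>* A A'" "stable S" "S \<subseteq> A"
  shows "S \<subseteq> A'"
  using assms by (induction rule: rtranclp_induct) (auto dest: erode_preserves_stable_subset)

text \<open>
  Erosion of a subset can follow the erosion of the whole set, skipping the vertices already absent.
  This makes erosion confluent: two erosions of the same set can be carried out one after the other.
\<close>

lemma erode_mono:
  assumes "erode A A'" "B \<subseteq> A"
  shows "\<exists>B'. erode\<^sup>*\<^sup>* B B' \<and> B' \<subseteq> A'"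
proof -
  obtain v where v: "deg_in E A v \<le> deg_in E (UNIV - A) v" "A' = A - {v}"
    using assms(1) unfolding erode_def by blast
  show ?thesis
  proof (cases "v \<in> B")
    case True
    have "deg_in E B v \<le> deg_in E A v"
      using assms(2) by (intro deg_in_mono) auto
    also have "\<dots> \<le> deg_in E (UNIV - A) v" by (rule v(1))
    also have "\<dots> \<le> deg_in E (UNIV - B) v"
      using assms(2) by (intro deg_in_mono) auto
    finally have "erode B (B - {v})"
      using True unfolding erode_def by blast
    then show ?thesis using v(2) assms(2) by blast
  next
    case False
    then show ?thesis using v(2) assms(2) by blast
  qed
qed

lemma erodes_mono:
  assumes "erode\<^sup>*\<^sup>* A A'" "B \<subseteq> A"
  shows "\<exists>B'. erode\<^sup>*\<^sup>* B B' \<and> B' \<subseteq> A'"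
  using assms
proof (induction rule: rtranclp_induct)
  case base
  then show ?case by blast
next
  case (step A1 A2)
  then obtain B1 where B1: "erode\<^sup>*\<^sup>* B B1" "B1 \<subseteq> A1" by blast
  obtain B2 where "erode\<^sup>*\<^sup>* B1 B2" "B2 \<subseteq> A2"
    using erode_mono[OF step.hyps(2) B1(2)] by blast
  then show ?case using B1(1) by (meson rtranclp_trans)
qed

lemma erodes_away_from_finite_set:
  assumes "finite D" "\<And>v. v \<in> D \<Longrightarrow> \<exists>A'. erode\<^sup>*\<^sup>* A A' \<and> v \<notin> A'"
  shows "\<exists>A'. erode\<^sup>*\<^sup>* A A' \<and> A' \<inter> D = {}"
  using assms
proof (induction D rule: finite_induct)
  case empty
  then show ?case by blast
next
  case (insert v D)
  obtain A1 where A1: "erode\<^sup>*\<^sup>* A A1" "A1 \<inter> D = {}" using insert by blast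
  obtain A2 where A2: "erode\<^sup>*\<^sup>* A A2" "v \<notin> A2" using insert by blast
  obtain A3 where A3: "erode\<^sup>*\<^sup>* A1 A3" "A3 \<subseteq> A2"
    using erodes_mono[OF A2(1) erodes_subset[OF A1(1)]] by blast
  have "A3 \<subseteq> A1" using erodes_subset[OF A3(1)] .
  then have "A3 \<inter> insert v D = {}" using A1 A2 A3 by blast
  moreover have "erode\<^sup>*\<^sup>* A A3" using A1(1) A3(1) by (rule rtranclp_trans)
  ultimately show ?case by blast
qed

text \<open>
  The vertices that no finite erosion of \<open>A\<close> removes form a stable set: a vertex has only finitely many
  neighbours, so one finite erosion removes all the removable ones among them, and if the vertex could be
  removed from the limit it could be removed at that time already.
\<close>

lemma erodes_outside_core:
  assumes "finite D" "D \<inter> core A = {}"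
  shows "\<exists>A'. erode\<^sup>*\<^sup>* A A' \<and> A' \<inter> D = {}"
proof -
  define F where "F = {v. \<exists>A'. erode\<^sup>*\<^sup>* A A' \<and> v \<notin> A'}"
  have "stable (A - F)"
    unfolding stable_def
  proof (rule ccontr)
    assume "\<not> (\<forall>v\<in>A - F. deg_in E (UNIV - (A - F)) v < deg_in E (A - F) v)"
    then obtain v where v: "v \<in> A - F" "deg_in E (A - F) v \<le> deg_in E (UNIV - (A - F)) v"
      by (auto simp: not_less)
    have "finite ({u. {v, u} \<in> E} \<inter> F)" using finite_nbrs by blast
    then obtain A' where A': "erode\<^sup>*\<^sup>* A A'" "A' \<inter> ({u. {v, u} \<in> E} \<inter> F) = {}"
      using erodes_away_from_finite_set[of "{u. {v, u} \<in> E} \<inter> F" A] unfolding F_def by blast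
    have sub: "A' \<subseteq> A" using erodes_subset[OF A'(1)] .
    have "v \<in> A'" using v(1) A'(1) unfolding F_def by blast
    have "deg_in E A' v \<le> deg_in E (A - F) v"
      using sub A'(2) by (intro deg_in_mono) auto
    also have "\<dots> \<le> deg_in E (UNIV - (A - F)) v" by (rule v(2))
    also have "\<dots> \<le> deg_in E (UNIV - A') v"
      using sub A'(2) by (intro deg_in_mono) auto
    finally have "erode A' (A' - {v})"
      using \<open>v \<in> A'\<close> unfolding erode_def by blast
    then have "erode\<^sup>*\<^sup>* A (A' - {v})" using A'(1) by (meson rtranclp.rtrancl_into_rtrancl)
    then have "v \<in> F" unfolding F_def by blast
    then show False using v(1) by blast
  qed
  then have "A - F \<subseteq> core A" by (intro stable_subset_core) auto
  moreover have "x \<in> F" if "x \<notin> A" for x using that unfolding F_def by blast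
  ultimately have "D \<subseteq> F" using assms(2) by blast
  then show ?thesis
    using assms(1) by (intro erodes_away_from_finite_set) (auto simp: F_def)
qed

section \<open>The size of the edge boundary\<close>

text \<open>
  Removing \<open>v\<close> deletes its edges to the outside from the boundary and adds its edges to the inside.
  The identity is stated with sums because subtraction of naturals truncates.
\<close>

lemma boundary_remove:
  assumes fin: "finite (boundary A)" and v: "v \<in> A"
  shows "finite (boundary (A - {v}))"
    and "card (boundary (A - {v})) + deg_in E (UNIV - A) v = card (boundary A) + deg_in E A v"
proof -
  let ?out = "{w \<in> UNIV - A. {v, w} \<in> E}" and ?in = "{w \<in> A. {v, w} \<in> E}"
  define K where "K = {(u, w). u \<in> A - {v} \<and> w \<notin> A \<and> {u, w} \<in> E}"
  have old: "boundary A = K \<union> Pair v ` ?out"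
    using v unfolding boundary_def K_def by auto
  have new: "boundary (A - {v}) = K \<union> (\<lambda>u. (u, v)) ` ?in"
    using v no_loop unfolding boundary_def K_def by (auto simp: insert_commute)
  have fK: "finite K" using fin old by simp
  have fo: "finite ?out" and fi: "finite ?in"
    by (rule finite_subset[OF _ finite_nbrs[of v]], blast)+
  show "finite (boundary (A - {v}))" unfolding new using fK fi by simp
  have "card (boundary A) = card K + card (Pair v ` ?out)"
    unfolding old using fK fo by (intro card_Un_disjoint) (auto simp: K_def)
  moreover have "card (boundary (A - {v})) = card K + card ((\<lambda>u. (u, v)) ` ?in)"
    unfolding new using fK fi v by (intro card_Un_disjoint) (auto simp: K_def)
  moreover have "card (Pair v ` ?out) = deg_in E (UNIV - A) v"
    unfolding deg_in_def by (intro card_image) (auto simp: inj_on_def)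
  moreover have "card ((\<lambda>u. (u, v)) ` ?in) = deg_in E A v"
    unfolding deg_in_def by (intro card_image) (auto simp: inj_on_def)
  ultimately show
    "card (boundary (A - {v})) + deg_in E (UNIV - A) v = card (boundary A) + deg_in E A v"
    by linarith
qed

lemma erodes_boundary:
  assumes "erode\<^sup>*\<^sup>* A A'" "finite (boundary A)"
  shows "finite (boundary A') \<and> card (boundary A') \<le> card (boundary A)"
  using assms
proof (induction rule: rtranclp_induct)
  case base
  then show ?case by blast
next
  case (step B C)
  then obtain v where "v \<in> B" "deg_in E B v \<le> deg_in E (UNIV - B) v" "C = B - {v}"
    unfolding erode_def by blast
  then show ?case using boundary_remove[of B v] step.IH step.prems by auto
qed

lemma finite_boundary_Compl: "finite (boundary A) \<Longrightarrow> finite (boundary (- A))"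
proof -
  assume "finite (boundary A)"
  moreover have "boundary (- A) \<subseteq> prod.swap ` boundary A"
    unfolding boundary_def by (auto simp: insert_commute image_iff)
  ultimately show ?thesis by (meson finite_imageI finite_subset)
qed

section \<open>Cores of translation-monotone sets\<close>

lemma invariant_shift_mult:
  assumes "invariant_shift d"
  shows "invariant_shift (k * d)"
proof -
  have nat: "invariant_shift (int n * d)" for n
  proof (induction n)
    case 0
    then show ?case by (simp add: invariant_shift_def)
  next
    case (Suc n)
    have "{x + int (Suc n) * d, y + int (Suc n) * d} \<in> E \<longleftrightarrow> {x, y} \<in> E" for x y
      using Suc assms[unfolded invariant_shift_def, rule_format, of "x + int n * d" "y + int n * d"]
      by (simp add: invariant_shift_def algebra_simps)
    then show ?case unfolding invariant_shift_def by blast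
  qed
  show ?thesis
  proof (cases "k \<ge> 0")
    case True
    then show ?thesis using nat[of "nat k"] by simp
  next
    case False
    then have inv: "invariant_shift (- k * d)" using nat[of "nat (- k)"] by simp
    have "{x + k * d, y + k * d} \<in> E \<longleftrightarrow> {x, y} \<in> E" for x y
      using inv[unfolded invariant_shift_def, rule_format, of "x + k * d" "y + k * d"] by simp
    then show ?thesis unfolding invariant_shift_def by blast
  qed
qed

lemma deg_in_shift:
  assumes "invariant_shift d"
  shows "deg_in E ((\<lambda>x. x + d) ` S) (u + d) = deg_in E S u"
proof -
  have "{v \<in> (\<lambda>x. x + d) ` S. {u + d, v} \<in> E} = (\<lambda>x. x + d) ` {v \<in> S. {u, v} \<in> E}"
    using assms unfolding invariant_shift_def by auto
  then show ?thesis
    unfolding deg_in_def by (simp add: card_image inj_on_def)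
qed

lemma stable_shift:
  assumes "invariant_shift d" "stable S"
  shows "stable ((\<lambda>x. x + d) ` S)"
proof -
  have "UNIV - (\<lambda>x. x + d) ` S = (\<lambda>x. x + d) ` (UNIV - S)"
    using bij_image_Compl_eq[of "\<lambda>x. x + d" S]
    by (simp add: Compl_eq_Diff_UNIV bij_def inj_def surj_def)
  then show ?thesis
    using assms unfolding stable_def by (auto simp: deg_in_shift)
qed

lemma core_closed:
  assumes inv: "invariant_shift d" and closed: "\<And>x. x \<in> P \<Longrightarrow> x + d \<in> P" and x: "x \<in> core P"
  shows "x + int j * d \<in> core P"
proof (induction j)
  case 0
  then show ?case using x by simp
next
  case (Suc j)
  have "(\<lambda>x. x + d) ` core P \<subseteq> core P"
    using stable_shift[OF inv stable_core] closed core_subset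
    by (intro stable_subset_core) auto
  then show ?case using Suc by (force simp: algebra_simps)
qed

text \<open>
  The edges of a path from \<open>q\<close> to \<open>f\<close>: a set that contains \<open>q\<close> but not \<open>f\<close> is left along one of them.
  What matters is that the finite set \<open>K\<close> serves for all \<open>Z\<close>.
\<close>

lemma finite_separating_edges:
  assumes "(\<lambda>u v. {u, v} \<in> E)\<^sup>*\<^sup>* q f"
  shows "\<exists>K. finite K \<and> (\<forall>u v. (u, v) \<in> K \<longrightarrow> {u, v} \<in> E) \<and>
    (\<forall>Z. q \<in> Z \<longrightarrow> f \<notin> Z \<longrightarrow> (\<exists>u v. (u, v) \<in> K \<and> u \<in> Z \<and> v \<notin> Z))"
  using assms
proof (induction rule: rtranclp_induct)
  case base
  then show ?case by blast
next
  case (step y z)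
  then obtain K where K: "finite K" "\<forall>u v. (u, v) \<in> K \<longrightarrow> {u, v} \<in> E"
    "\<forall>Z. q \<in> Z \<longrightarrow> y \<notin> Z \<longrightarrow> (\<exists>u v. (u, v) \<in> K \<and> u \<in> Z \<and> v \<notin> Z)" by blast
  have "finite (insert (y, z) K) \<and> (\<forall>u v. (u, v) \<in> insert (y, z) K \<longrightarrow> {u, v} \<in> E) \<and>
    (\<forall>Z. q \<in> Z \<longrightarrow> z \<notin> Z \<longrightarrow> (\<exists>u v. (u, v) \<in> insert (y, z) K \<and> u \<in> Z \<and> v \<notin> Z))"
  proof (intro conjI allI impI)
    fix Z assume Z: "q \<in> Z" "z \<notin> Z"
    show "\<exists>u v. (u, v) \<in> insert (y, z) K \<and> u \<in> Z \<and> v \<notin> Z"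
    proof (cases "y \<in> Z")
      case True
      then show ?thesis using Z(2) by blast
    next
      case False
      then show ?thesis using K(3) Z(1) by blast
    qed
  next
    show "finite (insert (y, z) K)" using K(1) by simp
  next
    fix u v assume "(u, v) \<in> insert (y, z) K"
    then show "{u, v} \<in> E" using K(2) step.hyps(2) by blast
  qed
  then show ?case by blast
qed

text \<open>
  If the class \<open>f + j * d\<close> missed the core, a finite erosion would remove its first \<open>J + 1\<close> members while
  all \<open>q + j * d\<close> remain. Translates of a path from \<open>q\<close> to \<open>f\<close> then yield a boundary edge for each
  \<open>j \<le> J\<close>, and distinct \<open>j\<close> using the same edge of the path yield distinct boundary edges. As erosion does not enlarge
  the boundary, \<open>J\<close> is bounded in terms of the path and \<open>P\<close>. The sign of \<open>d\<close> is left open so that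
  half-lines in both directions are covered.
\<close>

lemma core_absorbs:
  assumes conn: "graph_connected E" and inv: "invariant_shift d" and d: "d \<noteq> 0"
    and closed: "\<And>x. x \<in> P \<Longrightarrow> x + d \<in> P"
    and fin: "finite (boundary P)" and q: "q \<in> core P"
  shows "\<exists>j. f + int j * d \<in> core P"
proof (rule ccontr)
  assume "\<not> ?thesis"
  then have f: "f + int j * d \<notin> core P" for j by blast
  obtain K where K: "finite K" "\<And>u v. (u, v) \<in> K \<Longrightarrow> {u, v} \<in> E"
    "\<And>Z. q \<in> Z \<Longrightarrow> f \<notin> Z \<Longrightarrow> \<exists>u v. (u, v) \<in> K \<and> u \<in> Z \<and> v \<notin> Z"
    using finite_separating_edges[OF conn[unfolded graph_connected_def, rule_format, of q f]]
    by metis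
  define J where "J = card K * card (boundary P)"
  let ?D = "(\<lambda>j. f + int j * d) ` {..J}"
  have "?D \<inter> core P = {}" using f by auto
  then obtain Y where Y: "erode\<^sup>*\<^sup>* P Y" "Y \<inter> ?D = {}"
    using erodes_outside_core[of ?D P] by auto
  have core_Y: "core P \<subseteq> Y"
    using erodes_preserves_stable_subset[OF Y(1) stable_core core_subset] .
  have bY: "finite (boundary Y)" "card (boundary Y) \<le> card (boundary P)"
    using erodes_boundary[OF Y(1) fin] by auto
  have "\<exists>e. e \<in> K \<and> (fst e + int j * d, snd e + int j * d) \<in> boundary Y" if "j \<le> J" for j
  proof -
    let ?Z = "{x. x + int j * d \<in> Y}"
    have "q \<in> ?Z" using core_closed[OF inv closed q] core_Y by blast
    moreover have "f \<notin> ?Z" using Y(2) that by auto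
    ultimately obtain u v where uv: "(u, v) \<in> K" "u \<in> ?Z" "v \<notin> ?Z" using K(3) by blast
    have "{u + int j * d, v + int j * d} \<in> E"
      using invariant_shift_mult[OF inv] K(2)[OF uv(1)] unfolding invariant_shift_def by blast
    then show ?thesis using uv by (intro exI[of _ "(u, v)"]) (auto simp: boundary_def)
  qed
  then obtain e where e: "\<And>j. j \<le> J \<Longrightarrow> e j \<in> K"
    "\<And>j. j \<le> J \<Longrightarrow> (fst (e j) + int j * d, snd (e j) + int j * d) \<in> boundary Y"
    by metis
  have "card {..J} \<le> card (K \<times> boundary Y)"
  proof (rule card_inj_on_le)
    show "inj_on (\<lambda>j. (e j, (fst (e j) + int j * d, snd (e j) + int j * d))) {..J}"
      using d by (auto simp: inj_on_def)
  qed (use e K(1) bY(1) in auto)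
  also have "\<dots> \<le> J"
    using bY(2) by (simp add: card_cartesian_product J_def)
  finally show False by simp
qed

lemma core_absorbs_finite:
  assumes "graph_connected E" and inv: "invariant_shift d" and "d \<noteq> 0"
    and closed: "\<And>x. x \<in> P \<Longrightarrow> x + d \<in> P"
    and "finite (boundary P)" and "core P \<noteq> {}" and "finite R"
  shows "\<exists>J. \<forall>r\<in>R. \<forall>j\<ge>J. r + int j * d \<in> core P"
proof -
  have "\<forall>r. \<exists>j. r + int j * d \<in> core P"
    using core_absorbs[OF assms(1-3) closed assms(5)] assms(6) by blast
  then obtain g where g: "\<And>r. r + int (g r) * d \<in> core P" by metis
  have "r + int j * d \<in> core P" if "r \<in> R" "Max (g ` R) \<le> j" for r j
  proof -
    have "g r \<le> j" using that assms(7) by (meson Max_ge finite_imageI image_eqI le_trans)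
    then show ?thesis
      using core_closed[OF inv closed g, of r "j - g r"] by (simp add: algebra_simps of_nat_diff)
  qed
  then show ?thesis by blast
qed

end

section \<open>Half-lines in a periodic graph\<close>

locale periodic_graph =
  fixes E :: "int set set" and L :: int
  assumes in_class: "E \<in> graph_class" and period: "translation_period E L"

sublocale periodic_graph \<subseteq> locally_finite_graph E
proof
  show "simple_edges E" using in_class unfolding graph_class_def by blast
  show "finite {v. {u, v} \<in> E}" for u
    using in_class unfolding graph_class_def bounded_degree_def nbrs_def
    by (auto simp: insert_commute)
qed

context periodic_graph
begin

lemma L_pos: "L > 0"
  using period unfolding translation_period_def by simp

lemma connected: "graph_connected E"
  using in_class unfolding graph_class_def by blast

lemma invariant_period: "invariant_shift (k * L)"
  using period by (intro invariant_shift_mult) (auto simp: translation_period_def invariant_shift_def)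

lemma bounded_range:
  obtains M where "\<And>u v. {u, v} \<in> E \<Longrightarrow> \<bar>u - v\<bar> \<le> M"
proof -
  let ?R = "(\<Union>r\<in>{0..<L}. (\<lambda>v. \<bar>r - v\<bar>) ` {v. {r, v} \<in> E})"
  have fin: "finite ?R" using finite_nbrs by blast
  have "\<bar>u - v\<bar> \<le> Max ?R" if "{u, v} \<in> E" for u v
  proof -
    define k where "k = - (u div L)"
    have "u + k * L = u mod L" unfolding k_def by (simp add: minus_div_mult_eq_mod)
    then have r: "u + k * L \<in> {0..<L}" using L_pos by simp
    have "{u + k * L, v + k * L} \<in> E"
      using that invariant_period unfolding invariant_shift_def by blast
    then have "\<bar>(u + k * L) - (v + k * L)\<bar> \<in> ?R" using r by blast
    then show ?thesis using Max_ge[OF fin] by simp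
  qed
  then show ?thesis using that by blast
qed

text \<open>
  These sets are the left half-lines up to a finite change; they stay in the class under erosion.
\<close>

definition left_half :: "int set \<Rightarrow> bool" where
  "left_half X \<longleftrightarrow> (\<exists>a b. {..a} \<subseteq> X \<and> X \<subseteq> {..b})"

lemma finite_boundary_left_half:
  assumes "left_half X"
  shows "finite (boundary X)"
proof -
  obtain M where M: "\<And>u v. {u, v} \<in> E \<Longrightarrow> \<bar>u - v\<bar> \<le> M" using bounded_range by blast
  obtain a b where ab: "{..a} \<subseteq> X" "X \<subseteq> {..b}" using assms unfolding left_half_def by blast
  have "boundary X \<subseteq> {a - M..b} \<times> {a..b + M}"
  proof
    fix p assume "p \<in> boundary X"
    then obtain u v where p: "p = (u, v)" "u \<in> X" "v \<notin> X" "{u, v} \<in> E"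
      unfolding boundary_def by blast
    have "u \<le> b" "a < v" using ab p by (auto simp: not_le[symmetric])
    then show "p \<in> {a - M..b} \<times> {a..b + M}" using M[OF p(4)] p(1) by auto
  qed
  then show ?thesis by (rule finite_subset) simp
qed

lemma erode_left_half:
  assumes "left_half X" "erode X X'"
  shows "left_half X'"
proof -
  obtain v where v: "X' = X - {v}" using assms(2) unfolding erode_def by blast
  obtain a b where "{..a} \<subseteq> X" "X \<subseteq> {..b}" using assms(1) unfolding left_half_def by blast
  then have "{..min a (v - 1)} \<subseteq> X'" "X' \<subseteq> {..b}" using v by auto
  then show ?thesis unfolding left_half_def by blast
qed

lemma right_core_cofinite:
  assumes "core {0<..} \<noteq> {}"
  shows "\<exists>a. {a<..} \<subseteq> core {0<..}"
proof -
  have lh: "left_half {..0::int}" unfolding left_half_def by blast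
  have "finite (boundary {0<..})"
    using finite_boundary_Compl[OF finite_boundary_left_half[OF lh]] by (simp add: Compl_atMost)
  moreover have "invariant_shift L" using invariant_period[of 1] by simp
  ultimately have "\<exists>J. \<forall>r\<in>{0..<L}. \<forall>j\<ge>J. r + int j * L \<in> core {0<..}"
    using L_pos assms by (intro core_absorbs_finite connected) auto
  then obtain J where J: "\<And>r j. r \<in> {0..<L} \<Longrightarrow> j \<ge> J \<Longrightarrow> r + int j * L \<in> core {0<..}"
    by blast
  have "x \<in> core {0<..}" if "x > int J * L" for x
  proof -
    have "int J \<le> x div L" using zdiv_mono1[of "int J * L" x L] that L_pos by simp
    then have "x mod L + int (nat (x div L)) * L \<in> core {0<..}"
      using L_pos by (intro J) auto
    moreover have "int (nat (x div L)) = x div L" using \<open>int J \<le> x div L\<close> by simp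
    ultimately show ?thesis by (simp add: mod_div_mult_eq)
  qed
  then show ?thesis by blast
qed

lemma left_core_cofinite:
  assumes "core {..0} \<noteq> {}"
  shows "\<exists>b. {..b} \<subseteq> core {..0}"
proof -
  have lh: "left_half {..0::int}" unfolding left_half_def by blast
  have "invariant_shift (- L)" using invariant_period[of "-1"] by simp
  then have "\<exists>J. \<forall>r\<in>{0..<L}. \<forall>j\<ge>J. r + int j * (- L) \<in> core {..0}"
    using L_pos assms finite_boundary_left_half[OF lh]
    by (intro core_absorbs_finite connected) auto
  then obtain J where J: "\<And>r j. r \<in> {0..<L} \<Longrightarrow> j \<ge> J \<Longrightarrow> r + int j * (- L) \<in> core {..0}"
    by blast
  have "x \<in> core {..0}" if "x \<le> (- int J) * L" for x
  proof -
    have "x div L \<le> (- int J) * L div L" using that L_pos by (intro zdiv_mono1)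
    also have "\<dots> = - int J" using L_pos by (intro nonzero_mult_div_cancel_right) simp
    finally have "x div L \<le> - int J" .
    then have k: "int (nat (- (x div L))) = - (x div L)" "nat (- (x div L)) \<ge> J" by auto
    have "x mod L + int (nat (- (x div L))) * (- L) \<in> core {..0}"
      using L_pos k by (intro J) auto
    then show ?thesis unfolding k(1) by (simp add: mod_div_mult_eq)
  qed
  then show ?thesis by blast
qed

section \<open>The shrink property empties the core of a half-line\<close>

lemma exists_shift_below: "\<exists>n. x + n * L \<le> y"
proof -
  have "x + (- \<bar>x - y\<bar>) * L \<le> y"
    using mult_left_mono[of 1 L "\<bar>x - y\<bar>"] L_pos by auto
  then show ?thesis by blast
qed

text \<open>
  Otherwise \<open>{..0}\<close> and \<open>{0<..}\<close> have nonempty cores, each containing a half-line. A translate of the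
  right core, moved so far left that the two half-lines overlap by more than twice the range of
  the edges, meets the left core in a finite set. Around each vertex of the intersection,
  one of the two cores contains all neighbours, so the vertex sees only the other core, which is stable.
\<close>

lemma left_core_empty:
  assumes shrink: "shrink_property E" and right: "core {0<..} \<noteq> {}"
  shows "core {..0} = {}"
proof (rule ccontr)
  assume left: "core {..0} \<noteq> {}"
  obtain a where a: "{a<..} \<subseteq> core {0<..}" using right_core_cofinite[OF right] by blast
  obtain b where b: "{..b} \<subseteq> core {..0}" using left_core_cofinite[OF left] by blast
  obtain M where M: "\<And>u v. {u, v} \<in> E \<Longrightarrow> \<bar>u - v\<bar> \<le> M" using bounded_range by blast
  \<comment> \<open>The overlap leaves room for one edge length on either side of \<open>b - \<bar>M\<bar>\<close>.\<close>
  obtain n where n: "a + n * L \<le> b - 2 * \<bar>M\<bar> - 1" using exists_shift_below by blast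
  let ?s = "\<lambda>x. x + n * L"
  define Q where "Q = ?s ` core {0<..}"
  define W where "W = core {..0}"
  have stQ: "stable Q" unfolding Q_def by (intro stable_shift invariant_period stable_core)
  have stW: "stable W" unfolding W_def by (rule stable_core)
  have Q_sup: "x \<in> Q" if "x > a + n * L" for x
  proof -
    have "x - n * L \<in> core {0<..}" using a that by auto
    then show ?thesis unfolding Q_def by (force simp: image_iff)
  qed
  have W_sup: "x \<in> W" if "x \<le> b" for x using b that unfolding W_def by auto
  have "Q \<inter> W \<subseteq> {n * L..0}"
    using core_subset[of "{0<..}"] core_subset[of "{..0}"] unfolding Q_def W_def by force
  then have "finite (Q \<inter> W)" by (rule finite_subset) simp
  moreover have "stable (Q \<inter> W)"
    unfolding stable_def
  proof
    fix v assume v: "v \<in> Q \<inter> W"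
    have transfer: "deg_in E (UNIV - (Q \<inter> W)) v < deg_in E (Q \<inter> W) v"
      if "stable T" "v \<in> T" "\<And>u. {v, u} \<in> E \<Longrightarrow> u \<in> Q \<inter> W \<longleftrightarrow> u \<in> T" for T
    proof -
      have "deg_in E (UNIV - (Q \<inter> W)) v \<le> deg_in E (UNIV - T) v"
        using that(3) by (intro deg_in_mono) auto
      also have "\<dots> < deg_in E T v" using that(1,2) unfolding stable_def by blast
      also have "\<dots> \<le> deg_in E (Q \<inter> W) v"
        using that(3) by (intro deg_in_mono) auto
      finally show ?thesis .
    qed
    show "deg_in E (UNIV - (Q \<inter> W)) v < deg_in E (Q \<inter> W) v"
    proof (cases "v \<le> b - \<bar>M\<bar>")
      case True
      have "u \<in> W" if "{v, u} \<in> E" for u using M[OF that] True by (intro W_sup) linarith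
      then show ?thesis using v stQ by (intro transfer[of Q]) auto
    next
      case False
      have "u \<in> Q" if "{v, u} \<in> E" for u using M[OF that] False n by (intro Q_sup) linarith
      then show ?thesis using v stW by (intro transfer[of W]) auto
    qed
  qed
  moreover have "b \<in> Q \<inter> W" using n by (intro IntI Q_sup W_sup) linarith+
  ultimately show False
    using shrink unfolding shrink_property_iff_no_finite_stable_set by blast
qed

lemma left_half_core_empty:
  assumes "core {..0} = {}" "left_half X"
  shows "core X = {}"
proof -
  obtain b where b: "X \<subseteq> {..b}" using assms(2) unfolding left_half_def by blast
  obtain n where n: "b + n * L \<le> 0" using exists_shift_below by blast
  have "(\<lambda>x. x + n * L) ` core X \<subseteq> core {..0}"
  proof (rule stable_subset_core)
    show "stable ((\<lambda>x. x + n * L) ` core X)" by (intro stable_shift invariant_period stable_core)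
    show "(\<lambda>x. x + n * L) ` core X \<subseteq> {..0}" using core_subset[of X] b n by force
  qed
  then show ?thesis using assms(1) by blast
qed

text \<open>
  The time reversal at the heart of the proof. Since \<open>X\<close> has minimal boundary, the boundary stays constant along
  the erosion, so a removed vertex has as many neighbours inside as outside and could
  equally be removed from the complement after the step. If it were the last vertex of \<open>Q\<close>, that
  complement would contain \<open>Q\<close>, and stability of \<open>Q\<close> forbids such a removal.
\<close>

lemma minimal_boundary_blocks_erosion:
  assumes lh: "left_half X"
    and least: "\<And>Z. left_half Z \<Longrightarrow> card (boundary X) \<le> card (boundary Z)"
    and st: "stable Q" and meet: "Q \<inter> X \<noteq> {}" and "erode\<^sup>*\<^sup>* X Y"
  shows "left_half Y \<and> Q \<inter> Y \<noteq> {}"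
  using assms(5)
proof (induction rule: rtranclp_induct)
  case base
  then show ?case using lh meet by blast
next
  case (step Y Y')
  obtain v where v: "v \<in> Y" "Y' = Y - {v}" using step.hyps(2) unfolding erode_def by blast
  have lhY: "left_half Y" using step.IH by blast
  have lhY': "left_half Y'" using erode_left_half[OF lhY step.hyps(2)] .
  have "card (boundary Y) \<le> card (boundary X)"
    using erodes_boundary[OF step.hyps(1) finite_boundary_left_half[OF lh]] by blast
  also have "\<dots> \<le> card (boundary Y')" using least[OF lhY'] .
  \<comment> \<open>Minimality forces the opposite of the inequality that makes \<open>v\<close> removable.\<close>
  finally have tie: "deg_in E (UNIV - Y) v \<le> deg_in E Y v"
    using boundary_remove(2)[OF finite_boundary_left_half[OF lhY] v(1)] unfolding v(2) by linarith
  have "Q \<inter> Y' \<noteq> {}"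
  proof
    assume none: "Q \<inter> Y' = {}"
    then have vQ: "v \<in> Q" using step.IH v(2) by blast
    have nv: "u \<noteq> v" if "{v, u} \<in> E" for u using that no_loop by blast
    have "deg_in E Q v \<le> deg_in E (UNIV - Y) v"
      using none v(2) nv by (intro deg_in_mono) auto
    also have "\<dots> \<le> deg_in E Y v" by (rule tie)
    also have "\<dots> \<le> deg_in E (UNIV - Q) v"
      using none v(2) nv by (intro deg_in_mono) auto
    finally show False using st vQ unfolding stable_def by (meson leD)
  qed
  then show ?case using lhY' by blast
qed

text \<open>
  A translate of the right core reaching into a left half-line \<open>X\<close> of minimal boundary could be eroded
  away from \<open>X\<close>, whose core is empty, and could not be, by minimality.
\<close>

lemma shrink_property_core_empty:
  assumes shrink: "shrink_property E"
  shows "core {0<..} = {}"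
proof (rule ccontr)
  assume right: "core {0<..} \<noteq> {}"
  have lh0: "left_half {..0}" unfolding left_half_def by blast
  obtain X where lh: "left_half X"
    and least: "\<And>Z. left_half Z \<Longrightarrow> card (boundary X) \<le> card (boundary Z)"
    using ex_has_least_nat[of left_half, OF lh0, of "\<lambda>Z. card (boundary Z)"] by blast
  obtain a b where ab: "{..a} \<subseteq> X" "X \<subseteq> {..b}" using lh unfolding left_half_def by blast
  obtain q where q: "q \<in> core {0<..}" using right by blast
  obtain n where n: "q + n * L \<le> a" using exists_shift_below by blast
  define Q where "Q = (\<lambda>x. x + n * L) ` core {0<..}"
  have st: "stable Q" unfolding Q_def by (intro stable_shift invariant_period stable_core)
  have meet: "Q \<inter> X \<noteq> {}" using q n ab(1) unfolding Q_def by blast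
  have "Q \<inter> X \<subseteq> {n * L..b}"
    using core_subset[of "{0<..}"] ab(2) unfolding Q_def by force
  then have "finite (Q \<inter> X)" by (rule finite_subset) simp
  moreover have "core X = {}"
    using left_half_core_empty[OF left_core_empty[OF shrink right] lh] .
  ultimately obtain Y where Y: "erode\<^sup>*\<^sup>* X Y" "Y \<inter> (Q \<inter> X) = {}"
    using erodes_outside_core[of "Q \<inter> X" X] by blast
  then have "Q \<inter> Y = {}" using erodes_subset[OF Y(1)] by blast
  then show False
    using minimal_boundary_blocks_erosion[OF lh least st meet Y(1)] by blast
qed

lemma erosion_past_period_shrink_property:
  assumes er: "erode\<^sup>*\<^sup>* {0<..} A" and A: "A \<subseteq> {L<..}"
  shows "shrink_property E"
  unfolding shrink_property_iff_no_finite_stable_set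
proof (intro allI impI)
  fix S assume fin: "finite S" and st: "stable S"
  show "S = {}"
  proof (rule ccontr)
    assume ne: "S \<noteq> {}"
    \<comment> \<open>The multiple of the period that moves the minimum of \<open>S\<close> into \<open>{1..L}\<close>.\<close>
    define k where "k = - ((Min S - 1) div L)"
    have "Min S - 1 + k * L = (Min S - 1) mod L"
      unfolding k_def by (simp add: minus_div_mult_eq_mod)
    then have k: "0 < Min S + k * L" "Min S + k * L \<le> L"
      using pos_mod_sign[OF L_pos, of "Min S - 1"] pos_mod_bound[OF L_pos, of "Min S - 1"]
      by linarith+
    have "(\<lambda>x. x + k * L) ` S \<subseteq> {0<..}"
      using k(1) Min_le[OF fin] by force
    then have "(\<lambda>x. x + k * L) ` S \<subseteq> A"
      using erodes_preserves_stable_subset[OF er stable_shift[OF invariant_period st]] by blast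
    then show False using A k(2) Min_in[OF fin ne] by force
  qed
qed

section \<open>Flips of spins as erosion\<close>

definition spins :: "int set \<Rightarrow> config" where
  "spins A x = (if x \<in> A then 1 else -1)"

text \<open>
  At a plus spin, the sum over the neighbours counts plus neighbours positively and minus neighbours
  negatively, so the sign condition of a valid flip is the condition for an erosion step.
\<close>

lemma delta_H_spins:
  assumes "v \<in> A"
  shows "delta_H E v (spins A) = 2 * (int (deg_in E A v) - int (deg_in E (UNIV - A) v))"
proof -
  let ?N = "{u. {v, u} \<in> E}"
  have N: "nbrs E v = ?N" unfolding nbrs_def by (simp add: insert_commute)
  have "(\<Sum>u\<in>?N. spins A u * spins A v) = (\<Sum>u\<in>?N. if u \<in> A then 1 else -1)"
    using assms by (intro sum.cong) (auto simp: spins_def)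
  also have "\<dots> = int (card (?N \<inter> A)) - int (card (?N \<inter> - A))"
    using finite_nbrs[of v] by (simp add: sum.If_cases)
  also have "?N \<inter> A = {u \<in> A. {v, u} \<in> E}" by blast
  also have "?N \<inter> - A = {u \<in> UNIV - A. {v, u} \<in> E}" by blast
  finally show ?thesis unfolding delta_H_def N deg_in_def by simp
qed

lemma valid_flip_spins_iff:
  "valid_flip E (spins A) \<tau> \<longleftrightarrow> (\<exists>A'. erode A A' \<and> \<tau> = spins A')"
proof -
  have c: "spins A \<in> configs" unfolding configs_def spins_def by auto
  have one: "spins A v = 1 \<longleftrightarrow> v \<in> A" for v unfolding spins_def by auto
  have le: "delta_H E v (spins A) \<le> 0 \<longleftrightarrow> deg_in E A v \<le> deg_in E (UNIV - A) v" if "v \<in> A" for v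
    by (simp add: delta_H_spins[OF that])
  have upd: "(spins A)(v := -1) = spins (A - {v})" for v unfolding spins_def by auto
  show ?thesis
    unfolding valid_flip_def erode_def one upd using c le by blast
qed

lemma valid_flips_spins_iff:
  "(valid_flip E)\<^sup>*\<^sup>* (spins A) \<tau> \<longleftrightarrow> (\<exists>A'. erode\<^sup>*\<^sup>* A A' \<and> \<tau> = spins A')"
proof
  assume "(valid_flip E)\<^sup>*\<^sup>* (spins A) \<tau>"
  then show "\<exists>A'. erode\<^sup>*\<^sup>* A A' \<and> \<tau> = spins A'"
  proof (induction rule: rtranclp_induct)
    case base
    then show ?case by blast
  next
    case (step \<sigma> \<tau>)
    then show ?case
      using valid_flip_spins_iff by (metis rtranclp.rtrancl_into_rtrancl)
  qed
next
  assume "\<exists>A'. erode\<^sup>*\<^sup>* A A' \<and> \<tau> = spins A'"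
  then obtain A' where A': "erode\<^sup>*\<^sup>* A A'" "\<tau> = spins A'" by blast
  have "(valid_flip E)\<^sup>*\<^sup>* (spins A) (spins A')"
    using A'(1)
  proof (induction rule: rtranclp_induct)
    case base
    then show ?case by blast
  next
    case (step B C)
    then show ?case
      using valid_flip_spins_iff by (metis rtranclp.rtrancl_into_rtrancl)
  qed
  then show "(valid_flip E)\<^sup>*\<^sup>* (spins A) \<tau>" using A'(2) by simp
qed

lemma step_config_spins: "step_config = spins {0<..}"
  unfolding step_config_def spins_def by auto

lemma spins_le_translate_iff: "spins A \<le> translate L step_config \<longleftrightarrow> A \<subseteq> {L<..}"
  unfolding spins_def translate_def step_config_def le_fun_def by (auto split: if_splits)

end

theorem proposition1:
  fixes E :: "int set set" and L :: int
  assumes "E \<in> graph_class"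
    and "translation_period E L"
  shows "shrink_property E \<longleftrightarrow>
    (\<exists>\<sigma>. (valid_flip E)\<^sup>*\<^sup>* step_config \<sigma> \<and> \<sigma> \<le> translate L step_config)"
proof -
  interpret periodic_graph E L using assms by unfold_locales
  have "(\<exists>\<sigma>. (valid_flip E)\<^sup>*\<^sup>* step_config \<sigma> \<and> \<sigma> \<le> translate L step_config) \<longleftrightarrow>
      (\<exists>A. erode\<^sup>*\<^sup>* {0<..} A \<and> A \<subseteq> {L<..})"
    unfolding step_config_spins valid_flips_spins_iff
    using spins_le_translate_iff unfolding step_config_spins by blast
  also have "\<dots> \<longleftrightarrow> shrink_property E"
  proof
    assume "\<exists>A. erode\<^sup>*\<^sup>* {0<..} A \<and> A \<subseteq> {L<..}"
    then show "shrink_property E" using erosion_past_period_shrink_property by blast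
  next
    assume "shrink_property E"
    then have "{1..L} \<inter> core {0<..} = {}" using shrink_property_core_empty by blast
    then obtain A where A: "erode\<^sup>*\<^sup>* {0<..} A" "A \<inter> {1..L} = {}"
      using erodes_outside_core[of "{1..L}" "{0<..}"] by blast
    then have "A \<subseteq> {L<..}" using erodes_subset[OF A(1)] by force
    then show "\<exists>A. erode\<^sup>*\<^sup>* {0<..} A \<and> A \<subseteq> {L<..}" using A(1) by blast
  qed
  finally show ?thesis by blast
qed

end
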